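(* For unital 3-algebraic probability spaces $(\mathcal A_i,\varphi_i,\psi_i,\theta_i)$, $i=1,2$, $$(\mathcal A_1,\varphi_1,\psi_1,\theta_1)\leftthreetimes(\mathcal A_2,\varphi_2,\psi_2,\theta_2)=\big(\mathcal A_1\ast\mathcal A_2,\ \varphi_1\,{}_{\theta_1}\!\ast_{\psi_2}\varphi_2,\ \psi_1\,{}_{\theta_1}\!\ast_{\psi_2}\psi_2,\ \theta_1\,{}_{\theta_1}\!\ast_{\psi_2}\theta_2\big).$$
   Context: Algebras are over $\mathbb C$. A unital 3-algebraic probability space is a unital algebra with three unital linear functionals. $\mathcal A_1\ast\mathcal A_2$ is the unital free product (coproduct of unital algebras); each $\mathcal A_i$ is regarded as a subalgebra. **c-free product.** For unital linear functionals $\varphi_i,\psi_i$ on $\mathcal A_i$ ($i=1,2$), $\varphi_1\,{}_{\psi_1}\!\ast_{\psi_2}\varphi_2$ denotes the unique unital linear functional $\varphi$ on $\mathcal A_1\ast\mathcal A_2$ such that $\varphi(a_1\cdots a_n)=\prod_{k=1}^n\varphi_{i_k}(a_k)$ whenever $n\ge1$, $i_1,\dots,i_n\in\{1,2\}$ with $i_k\neq i_{k+1}$ for all $k$, $a_k\in\mathcal A_{i_k}$ and $\psi_{i_k}(a_k)=0$ for all $k\in[n]$. **$\alpha$-free product** (over $I=\{1,2\}$ with $1<2$). $I^\ast$ is the set of finite sequences $\mathbf i=(i_1,\dots,i_n)$, $n\ge1$, in $I$ with $i_k\ne i_{k+1}$. $\mathrm{Peak}(\mathbf i)=\{k\in\{2,\dots,n-1\}: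 i_{k-1}<i_k>i_{k+1}\}$, $\mathrm{Bot}(\mathbf i)=\{k\in\{2,\dots,n-1\}: i_{k-1}>i_k<i_{k+1}\}$. Define linear functionals on $\mathcal A_{i_k}$: $\alpha_{\mathbf i,1}=\varphi_{i_1}$, $\alpha_{\mathbf i,k}=\psi_{i_k}$ if $k\in\mathrm{Peak}(\mathbf i)$, $\theta_{i_k}$ if $k\in\mathrm{Bot}(\mathbf i)$, $0$ otherwise; $\beta_{\mathbf i,k}$ (resp. $\gamma_{\mathbf i,k}$) is the same with $\varphi_{i_1}$ replaced by $\psi_{i_1}$ (resp. $\theta_{i_1}$). Then $(\mathcal A_1,\varphi_1,\psi_1,\theta_1)\leftthreetimes(\mathcal A_2,\varphi_2,\psi_2,\theta_2)$ is the unique tuple $(\mathcal A_1\ast\mathcal A_2,\varphi,\psi,\theta)$ with unital linear functionals such that for every $\mathbf i\in I^\ast$, $a_k\in\mathcal A_{i_k}$: $\varphi(a_1\cdots a_n)=0$ if all $a_k\in\ker\alpha_{\mathbf i,k}$; $\psi(a_1\cdots a_n)=0$ if all $a_k\in\ker\beta_{\mathbf i,k}$; $\theta(a_1\cdots a_n)=0$ if all $a_k\in\ker\gamma_{\mathbf i,k}$. *)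

theory Defs
  imports Complex_Main
begin

section \<open>Unital complex algebras and unital linear functionals\<close>

text \<open>The library class of unital rings requires \<open>0 \<noteq> 1\<close>; here the zero algebra is
  admitted, so that the coproduct below exists without further assumptions.  An algebra that
  carries a unital linear functional is nonzero.\<close>

class complex_algebra_1 = ring + monoid_mult +
  fixes scaleC :: "complex \<Rightarrow> 'a \<Rightarrow> 'a"  (infixr "*\<^sub>C" 75)
  assumes scaleC_add_right: "c *\<^sub>C (x + y) = c *\<^sub>C x + c *\<^sub>C y"
    and scaleC_add_left: "(c + d) *\<^sub>C x = c *\<^sub>C x + d *\<^sub>C x"
    and scaleC_scaleC: "c *\<^sub>C d *\<^sub>C x = (c * d) *\<^sub>C x"
    and scaleC_one: "1 *\<^sub>C x = x"
    and mult_scaleC_left: "(c *\<^sub>C x) * y = c *\<^sub>C (x * y)"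
    and mult_scaleC_right: "x * (c *\<^sub>C y) = c *\<^sub>C (x * y)"

interpretation complex_algebra: vector_space "scaleC :: complex \<Rightarrow> 'a \<Rightarrow> 'a::complex_algebra_1"
  by unfold_locales
    (simp_all add: scaleC_add_right scaleC_add_left scaleC_scaleC scaleC_one)

definition unital_functional :: "('a::complex_algebra_1 \<Rightarrow> complex) \<Rightarrow> bool" where
  "unital_functional \<phi> \<longleftrightarrow> Vector_Spaces.linear scaleC (*) \<phi> \<and> \<phi> 1 = 1"

definition unital_hom :: "('a::complex_algebra_1 \<Rightarrow> 'b::complex_algebra_1) \<Rightarrow> bool" where
  "unital_hom f \<longleftrightarrow> Vector_Spaces.linear scaleC scaleC f \<and>
     (\<forall>x y. f (x * y) = f x * f y) \<and> f 1 = 1"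


section \<open>The unital free product\<close>

text \<open>The free product is the algebra presented by the elements of both algebras as generators,
  subject to the axioms of unital complex algebras and to the relations that make the two
  inclusions unital homomorphisms.  There are no separate terms for zero, one and negation:
  they are represented by \<open>Left 0\<close>, \<open>Left 1\<close> and scaling by \<open>-1\<close>.\<close>

datatype ('a, 'b) fp_term =
    Left 'a
  | Right 'b
  | Add "('a, 'b) fp_term" "('a, 'b) fp_term"
  | Mul "('a, 'b) fp_term" "('a, 'b) fp_term"
  | Scale complex "('a, 'b) fp_term"

inductive fp_rel ::
  "('a::complex_algebra_1, 'b::complex_algebra_1) fp_term \<Rightarrow> ('a, 'b) fp_term \<Rightarrow> bool"
where
  fp_refl: "fp_rel s s"
| fp_sym: "fp_rel s t \<Longrightarrow> fp_rel t s"
| fp_trans: "fp_rel s t \<Longrightarrow> fp_rel t u \<Longrightarrow> fp_rel s u"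
| fp_Add: "fp_rel s s' \<Longrightarrow> fp_rel t t' \<Longrightarrow> fp_rel (Add s t) (Add s' t')"
| fp_Mul: "fp_rel s s' \<Longrightarrow> fp_rel t t' \<Longrightarrow> fp_rel (Mul s t) (Mul s' t')"
| fp_Scale: "fp_rel s s' \<Longrightarrow> fp_rel (Scale c s) (Scale c s')"
| fp_add_assoc: "fp_rel (Add (Add s t) u) (Add s (Add t u))"
| fp_add_commute: "fp_rel (Add s t) (Add t s)"
| fp_add_zero: "fp_rel (Add (Left 0) s) s"
| fp_add_neg: "fp_rel (Add (Scale (-1) s) s) (Left 0)"
| fp_mult_assoc: "fp_rel (Mul (Mul s t) u) (Mul s (Mul t u))"
| fp_mult_1_left: "fp_rel (Mul (Left 1) s) s"
| fp_mult_1_right: "fp_rel (Mul s (Left 1)) s"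
| fp_distrib_right: "fp_rel (Mul (Add s t) u) (Add (Mul s u) (Mul t u))"
| fp_distrib_left: "fp_rel (Mul s (Add t u)) (Add (Mul s t) (Mul s u))"
| fp_scale_add_right: "fp_rel (Scale c (Add s t)) (Add (Scale c s) (Scale c t))"
| fp_scale_add_left: "fp_rel (Scale (c + d) s) (Add (Scale c s) (Scale d s))"
| fp_scale_scale: "fp_rel (Scale c (Scale d s)) (Scale (c * d) s)"
| fp_scale_one: "fp_rel (Scale 1 s) s"
| fp_mult_scale_left: "fp_rel (Mul (Scale c s) t) (Scale c (Mul s t))"
| fp_mult_scale_right: "fp_rel (Mul s (Scale c t)) (Scale c (Mul s t))"
| fp_Left_add: "fp_rel (Left (a + a')) (Add (Left a) (Left a'))"
| fp_Left_mult: "fp_rel (Left (a * a')) (Mul (Left a) (Left a'))"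
| fp_Left_scale: "fp_rel (Left (c *\<^sub>C a)) (Scale c (Left a))"
| fp_Right_add: "fp_rel (Right (b + b')) (Add (Right b) (Right b'))"
| fp_Right_mult: "fp_rel (Right (b * b')) (Mul (Right b) (Right b'))"
| fp_Right_scale: "fp_rel (Right (c *\<^sub>C b)) (Scale c (Right b))"
| fp_Right_one: "fp_rel (Right 1) (Left 1)"

quotient_type (overloaded) ('a, 'b) free_product =
  "('a::complex_algebra_1, 'b::complex_algebra_1) fp_term" / fp_rel
  by (intro equivpI reflpI sympI transpI) (blast intro: fp_rel.intros)+

instantiation free_product :: (complex_algebra_1, complex_algebra_1) complex_algebra_1
begin

lift_definition zero_free_product :: "('a, 'b) free_product" is "Left 0" .
lift_definition one_free_product :: "('a, 'b) free_product" is "Left 1" .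
lift_definition plus_free_product ::
    "('a, 'b) free_product \<Rightarrow> ('a, 'b) free_product \<Rightarrow> ('a, 'b) free_product"
  is Add by (rule fp_Add)
lift_definition times_free_product ::
    "('a, 'b) free_product \<Rightarrow> ('a, 'b) free_product \<Rightarrow> ('a, 'b) free_product"
  is Mul by (rule fp_Mul)
lift_definition scaleC_free_product ::
    "complex \<Rightarrow> ('a, 'b) free_product \<Rightarrow> ('a, 'b) free_product"
  is Scale by (rule fp_Scale)
lift_definition uminus_free_product :: "('a, 'b) free_product \<Rightarrow> ('a, 'b) free_product"
  is "Scale (-1)" by (rule fp_Scale)
lift_definition minus_free_product ::
    "('a, 'b) free_product \<Rightarrow> ('a, 'b) free_product \<Rightarrow> ('a, 'b) free_product"
  is "\<lambda>s t. Add s (Scale (-1) t)" by (intro fp_Add fp_Scale)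

instance
  by standard (transfer, blast intro: fp_rel.intros)+

end

lift_definition fp_inl :: "'a::complex_algebra_1 \<Rightarrow> ('a, 'b::complex_algebra_1) free_product"
  is Left .
lift_definition fp_inr :: "'b::complex_algebra_1 \<Rightarrow> ('a::complex_algebra_1, 'b) free_product"
  is Right .

lemma unital_homI:
  assumes "\<And>x y. f (x + y) = f x + f y" "\<And>c x. f (c *\<^sub>C x) = c *\<^sub>C f x"
    "\<And>x y. f (x * y) = f x * f y" "f 1 = 1"
  shows "unital_hom f"
  using assms unfolding unital_hom_def
  by (auto intro!: Vector_Spaces.linear.intro module_hom.intro module_hom_axioms.intro
      complex_algebra.vector_space_axioms complex_algebra.module_axioms)

lemma unital_homD:
  assumes "unital_hom f"
  shows "f (x + y) = f x + f y" "f (c *\<^sub>C x) = c *\<^sub>C f x" "f (x * y) = f x * f y"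
    "f 1 = 1" "f 0 = 0"
proof -
  interpret Vector_Spaces.linear scaleC scaleC f
    using assms by (simp add: unital_hom_def)
  show "f (x + y) = f x + f y" "f (c *\<^sub>C x) = c *\<^sub>C f x" "f 0 = 0"
    by (simp_all add: add scale)
  show "f (x * y) = f x * f y" "f 1 = 1"
    using assms by (simp_all add: unital_hom_def)
qed

lemma unital_hom_fp_inl: "unital_hom fp_inl"
  by (intro unital_homI; transfer; blast intro: fp_rel.intros)

lemma unital_hom_fp_inr: "unital_hom fp_inr"
  by (intro unital_homI; transfer; blast intro: fp_rel.intros)

primrec fp_eval ::
  "('a \<Rightarrow> 'c::complex_algebra_1) \<Rightarrow> ('b \<Rightarrow> 'c) \<Rightarrow> ('a, 'b) fp_term \<Rightarrow> 'c" where
  "fp_eval f g (Left a) = f a"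
| "fp_eval f g (Right b) = g b"
| "fp_eval f g (Add s t) = fp_eval f g s + fp_eval f g t"
| "fp_eval f g (Mul s t) = fp_eval f g s * fp_eval f g t"
| "fp_eval f g (Scale c s) = c *\<^sub>C fp_eval f g s"

lemma fp_eval_cong:
  assumes "fp_rel s t" "unital_hom f" "unital_hom g"
  shows "fp_eval f g s = fp_eval f g t"
  using assms(1)
  by induction
    (simp_all add: unital_homD[OF assms(2)] unital_homD[OF assms(3)] algebra_simps
      scaleC_add_right scaleC_add_left scaleC_scaleC scaleC_one
      mult_scaleC_left mult_scaleC_right)

theorem free_product_universal:
  fixes f :: "'a::complex_algebra_1 \<Rightarrow> 'c::complex_algebra_1"
    and g :: "'b::complex_algebra_1 \<Rightarrow> 'c"
  assumes "unital_hom f" "unital_hom g"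
  shows "\<exists>!h. unital_hom h \<and> h \<circ> fp_inl = f \<and> h \<circ> fp_inr = g"
proof (rule ex_ex1I)
  define h where "h x = fp_eval f g (rep_free_product x)" for x
  have *: "h (abs_free_product s) = fp_eval f g s" for s
    unfolding h_def
    by (rule fp_eval_cong[OF _ assms])
      (simp add: Quotient3_rep_abs[OF Quotient3_free_product] fp_refl)
  have ex: "\<exists>s. x = abs_free_product s" for x :: "('a, 'b) free_product"
    by (metis Quotient3_abs_rep[OF Quotient3_free_product])
  have "unital_hom h"
  proof (rule unital_homI)
    show "h (x + y) = h x + h y" for x y
      using ex[of x] ex[of y] by (auto simp: plus_free_product.abs_eq *)
    show "h (x * y) = h x * h y" for x y
      using ex[of x] ex[of y] by (auto simp: times_free_product.abs_eq *)
    show "h (c *\<^sub>C x) = c *\<^sub>C h x" for c x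
      using ex[of x] by (auto simp: scaleC_free_product.abs_eq *)
    show "h 1 = 1"
      by (simp add: one_free_product.abs_eq * unital_homD[OF assms(1)])
  qed
  moreover have "h \<circ> fp_inl = f" "h \<circ> fp_inr = g"
    by (simp_all add: fun_eq_iff fp_inl.abs_eq fp_inr.abs_eq *)
  ultimately show "\<exists>h. unital_hom h \<and> h \<circ> fp_inl = f \<and> h \<circ> fp_inr = g"
    by blast
next
  fix h k :: "('a, 'b) free_product \<Rightarrow> 'c"
  assume h: "unital_hom h \<and> h \<circ> fp_inl = f \<and> h \<circ> fp_inr = g"
    and k: "unital_hom k \<and> k \<circ> fp_inl = f \<and> k \<circ> fp_inr = g"
  have eq: "h (fp_inl a) = k (fp_inl a)" "h (fp_inr b) = k (fp_inr b)" for a b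
    using h k by (metis comp_apply)+
  have "h (abs_free_product s) = k (abs_free_product s)" for s
    by (induction s)
      (use h k eq in \<open>auto simp: unital_homD plus_free_product.abs_eq[symmetric]
        times_free_product.abs_eq[symmetric] scaleC_free_product.abs_eq[symmetric]
        fp_inl.abs_eq[symmetric] fp_inr.abs_eq[symmetric]\<close>)
  then show "h = k"
    by (metis Quotient3_abs_rep[OF Quotient3_free_product] ext)
qed


section \<open>Words\<close>

text \<open>A word \<open>a\<^sub>1 \<dots> a\<^sub>n\<close> with \<open>a\<^sub>k \<in> \<A>\<^bsub>i\<^sub>k\<^esub>\<close> is a list over the sum type; \<open>index\<close> recovers
  \<open>i\<^sub>k\<close>.  A pair \<open>(\<chi>\<^sub>1, \<chi>\<^sub>2)\<close> of functionals is applied to a letter by \<open>case_sum \<chi>\<^sub>1 \<chi>\<^sub>2\<close>.\<close>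

definition index :: "'a + 'b \<Rightarrow> nat" where
  "index = case_sum (\<lambda>_. 1) (\<lambda>_. 2)"

definition word_prod ::
  "('a::complex_algebra_1 + 'b::complex_algebra_1) list \<Rightarrow> ('a, 'b) free_product" where
  "word_prod xs = prod_list (map (case_sum fp_inl fp_inr) xs)"

definition I_star :: "nat list set" where
  "I_star = {is. is \<noteq> [] \<and> set is \<subseteq> {1, 2} \<and> successively (\<noteq>) is}"


section \<open>The c-free product\<close>

definition is_cfree_product ::
  "('a::complex_algebra_1 \<Rightarrow> complex) \<Rightarrow> ('a \<Rightarrow> complex) \<Rightarrow>
   ('b::complex_algebra_1 \<Rightarrow> complex) \<Rightarrow> ('b \<Rightarrow> complex) \<Rightarrow>
   (('a, 'b) free_product \<Rightarrow> complex) \<Rightarrow> bool" where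
  "is_cfree_product \<phi>\<^sub>1 \<psi>\<^sub>1 \<psi>\<^sub>2 \<phi>\<^sub>2 \<phi> \<longleftrightarrow>
     unital_functional \<phi> \<and>
     (\<forall>is\<in>I_star. \<forall>xs. map index xs = is \<longrightarrow>
        (\<forall>k<length xs. case_sum \<psi>\<^sub>1 \<psi>\<^sub>2 (xs ! k) = 0) \<longrightarrow>
        \<phi> (word_prod xs) = (\<Prod>k<length xs. case_sum \<phi>\<^sub>1 \<phi>\<^sub>2 (xs ! k)))"

definition cfree_product ::
  "('a::complex_algebra_1 \<Rightarrow> complex) \<Rightarrow> ('a \<Rightarrow> complex) \<Rightarrow>
   ('b::complex_algebra_1 \<Rightarrow> complex) \<Rightarrow> ('b \<Rightarrow> complex) \<Rightarrow>
   ('a, 'b) free_product \<Rightarrow> complex" where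
  "cfree_product \<phi>\<^sub>1 \<psi>\<^sub>1 \<psi>\<^sub>2 \<phi>\<^sub>2 = (THE \<phi>. is_cfree_product \<phi>\<^sub>1 \<psi>\<^sub>1 \<psi>\<^sub>2 \<phi>\<^sub>2 \<phi>)"


section \<open>The $\alpha$-free product\<close>

text \<open>List positions start at 0, so the interior positions \<open>2, \<dots>, n - 1\<close> of a sequence of
  length \<open>n\<close> become \<open>1, \<dots>, n - 2\<close>.\<close>

definition Peak :: "nat list \<Rightarrow> nat set" where
  "Peak is = {k. 0 < k \<and> Suc k < length is \<and> is ! (k - 1) < is ! k \<and> is ! k > is ! Suc k}"

definition Bot :: "nat list \<Rightarrow> nat set" where
  "Bot is = {k. 0 < k \<and> Suc k < length is \<and> is ! (k - 1) > is ! k \<and> is ! k < is ! Suc k}"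

text \<open>With \<open>\<chi>\<close> the family \<open>\<phi>\<close>, \<open>\<psi>\<close> or \<open>\<theta>\<close>, the following is \<open>\<alpha>\<^bsub>i,k\<^esub>\<close>, \<open>\<beta>\<^bsub>i,k\<^esub>\<close> or \<open>\<gamma>\<^bsub>i,k\<^esub>\<close>
  respectively; its value is meaningful on letters of index \<open>i\<^sub>k\<close>.\<close>

definition word_functional ::
  "('a + 'b \<Rightarrow> complex) \<Rightarrow> ('a + 'b \<Rightarrow> complex) \<Rightarrow> ('a + 'b \<Rightarrow> complex) \<Rightarrow>
   nat list \<Rightarrow> nat \<Rightarrow> 'a + 'b \<Rightarrow> complex" where
  "word_functional \<chi> \<psi> \<theta> is k =
     (if k = 0 then \<chi> else if k \<in> Peak is then \<psi> else if k \<in> Bot is then \<theta> else (\<lambda>_. 0))"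

definition vanishes_on_kernels ::
  "(nat list \<Rightarrow> nat \<Rightarrow> 'a + 'b \<Rightarrow> complex) \<Rightarrow>
   (('a::complex_algebra_1, 'b::complex_algebra_1) free_product \<Rightarrow> complex) \<Rightarrow> bool" where
  "vanishes_on_kernels \<alpha> \<phi> \<longleftrightarrow>
     (\<forall>is\<in>I_star. \<forall>xs. map index xs = is \<longrightarrow>
        (\<forall>k<length xs. \<alpha> is k (xs ! k) = 0) \<longrightarrow> \<phi> (word_prod xs) = 0)"

type_synonym 'a functional3 = "('a \<Rightarrow> complex) \<times> ('a \<Rightarrow> complex) \<times> ('a \<Rightarrow> complex)"

fun is_alpha_free_product ::
  "'a::complex_algebra_1 functional3 \<Rightarrow> 'b::complex_algebra_1 functional3 \<Rightarrow>
   ('a, 'b) free_product functional3 \<Rightarrow> bool" where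
  "is_alpha_free_product (\<phi>\<^sub>1, \<psi>\<^sub>1, \<theta>\<^sub>1) (\<phi>\<^sub>2, \<psi>\<^sub>2, \<theta>\<^sub>2) (\<phi>, \<psi>, \<theta>) \<longleftrightarrow>
     unital_functional \<phi> \<and> unital_functional \<psi> \<and> unital_functional \<theta> \<and>
     vanishes_on_kernels
       (word_functional (case_sum \<phi>\<^sub>1 \<phi>\<^sub>2) (case_sum \<psi>\<^sub>1 \<psi>\<^sub>2) (case_sum \<theta>\<^sub>1 \<theta>\<^sub>2)) \<phi> \<and>
     vanishes_on_kernels
       (word_functional (case_sum \<psi>\<^sub>1 \<psi>\<^sub>2) (case_sum \<psi>\<^sub>1 \<psi>\<^sub>2) (case_sum \<theta>\<^sub>1 \<theta>\<^sub>2)) \<psi> \<and>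
     vanishes_on_kernels
       (word_functional (case_sum \<theta>\<^sub>1 \<theta>\<^sub>2) (case_sum \<psi>\<^sub>1 \<psi>\<^sub>2) (case_sum \<theta>\<^sub>1 \<theta>\<^sub>2)) \<theta>"

definition alpha_free_product ::
  "'a::complex_algebra_1 functional3 \<Rightarrow> 'b::complex_algebra_1 functional3 \<Rightarrow>
   ('a, 'b) free_product functional3" where
  "alpha_free_product S\<^sub>1 S\<^sub>2 = (THE S. is_alpha_free_product S\<^sub>1 S\<^sub>2 S)"

end

theory Submission imports Defs begin

text \<open>In an alternating word over two indices every interior letter is a peak (index 2) or a bottom
  (index 1), so the interior letters of the words defining the \<open>\<alpha>\<close>-free product are exactly
  those centred with respect to \<open>(\<theta>\<^sub>1, \<psi>\<^sub>2)\<close>.  Splitting off scalar parts at the two ends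
  of a word, the vanishing condition with first functional \<open>\<chi>\<close> becomes the product formula
  \<open>\<phi>(a\<^sub>1 \<dots> a\<^sub>n) = \<Prod> \<chi>(a\<^sub>k)\<close>, i.e. c-freeness.  The c-free functional is unique because centred
  alternating words span the free product.  It exists because the free product acts from the right on
  the functionals on alternating words; the c-free functional evaluates at the empty word the
  image of the functional \<open>a\<^sub>1 \<dots> a\<^sub>n \<mapsto> \<Prod> (\<chi>(a\<^sub>k) - \<omega>(a\<^sub>k))\<close>.\<close>

section \<open>Linearity rules for unital functionals\<close>

lemma unital_functionalD:
  assumes "unital_functional \<phi>"
  shows "\<phi> (x + y) = \<phi> x + \<phi> y" "\<phi> (c *\<^sub>C x) = c * \<phi> x" "\<phi> (x - y) = \<phi> x - \<phi> y"
    "\<phi> 0 = 0" "\<phi> 1 = 1"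
proof -
  interpret Vector_Spaces.linear scaleC "(*)" \<phi>
    using assms by (simp add: unital_functional_def)
  show "\<phi> (x + y) = \<phi> x + \<phi> y" "\<phi> (c *\<^sub>C x) = c * \<phi> x" "\<phi> (x - y) = \<phi> x - \<phi> y" "\<phi> 0 = 0"
    by (simp_all add: add scale diff)
  show "\<phi> 1 = 1"
    using assms by (simp add: unital_functional_def)
qed

lemma vector_space_complex: "vector_space ((*) :: complex \<Rightarrow> complex \<Rightarrow> complex)"
  by unfold_locales (simp_all add: algebra_simps)

lemma unital_functionalI:
  assumes "\<And>x y. \<phi> (x + y) = \<phi> x + \<phi> y" "\<And>c x. \<phi> (c *\<^sub>C x) = c * \<phi> x" "\<phi> 1 = 1"
  shows "unital_functional \<phi>"
proof -
  interpret C: vector_space "(*) :: complex \<Rightarrow> complex \<Rightarrow> complex"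
    by (rule vector_space_complex)
  show ?thesis
    using assms unfolding unital_functional_def
    by (auto intro!: Vector_Spaces.linear.intro module_hom.intro module_hom_axioms.intro
        complex_algebra.vector_space_axioms complex_algebra.module_axioms
        C.vector_space_axioms C.module_axioms)
qed

section \<open>Alternating words\<close>

abbreviation alternating :: "('a + 'b) list \<Rightarrow> bool" where
  "alternating \<equiv> successively (\<lambda>x y. index x \<noteq> index y)"

lemma index_simps [simp]: "index (Inl a) = 1" "index (Inr b) = 2"
  by (simp_all add: index_def)

lemma index_range: "index x = 1 \<or> index x = 2"
  by (cases x) simp_all

lemma map_index_in_I_star_iff: "map index xs \<in> I_star \<longleftrightarrow> xs \<noteq> [] \<and> alternating xs"
proof -
  have "set (map index xs) \<subseteq> {1, 2}"
    using index_range by auto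
  then show ?thesis
    by (auto simp: I_star_def successively_map)
qed

lemma alternating_cong: "map index xs = map index ys \<Longrightarrow> alternating xs \<longleftrightarrow> alternating ys"
  by (metis successively_map[of "(\<noteq>)"])

lemma alternating_replace:
  "index x = index y \<Longrightarrow> alternating (us @ x # vs) \<longleftrightarrow> alternating (us @ y # vs)"
  by (rule alternating_cong) simp

lemma alternating_nth:
  "alternating xs \<Longrightarrow> Suc k < length xs \<Longrightarrow> index (xs ! k) \<noteq> index (xs ! Suc k)"
proof (induction xs arbitrary: k)
  case (Cons x xs)
  then show ?case
    by (cases k; cases xs) auto
qed simp

abbreviation letter :: "'a::complex_algebra_1 + 'b::complex_algebra_1 \<Rightarrow> ('a, 'b) free_product" where
  "letter \<equiv> case_sum fp_inl fp_inr"

lemma word_prod_simps [simp]: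
  "word_prod [] = 1" "word_prod (x # xs) = letter x * word_prod xs"
  "word_prod (xs @ ys) = word_prod xs * word_prod ys"
  by (simp_all add: word_prod_def)

definition center :: "('a + 'b \<Rightarrow> complex) \<Rightarrow>
    'a::complex_algebra_1 + 'b::complex_algebra_1 \<Rightarrow> 'a + 'b" where
  "center \<omega> x = (case x of Inl a \<Rightarrow> Inl (a - \<omega> x *\<^sub>C 1) | Inr b \<Rightarrow> Inr (b - \<omega> x *\<^sub>C 1))"

lemma index_center [simp]: "index (center \<omega> x) = index x"
  by (cases x) (simp_all add: center_def)

lemma unital_hom_diff: "unital_hom f \<Longrightarrow> f (x - y) = f x - f y"
  by (metis add_diff_cancel diff_add_cancel unital_homD(1))

lemma letter_center: "letter (center \<omega> x) = letter x - \<omega> x *\<^sub>C 1"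
  by (cases x)
    (simp_all add: center_def unital_hom_diff unital_homD unital_hom_fp_inl unital_hom_fp_inr)

lemma functional_center:
  assumes "unital_functional \<chi>\<^sub>1" "unital_functional \<chi>\<^sub>2"
  shows "case_sum \<chi>\<^sub>1 \<chi>\<^sub>2 (center \<omega> x) = case_sum \<chi>\<^sub>1 \<chi>\<^sub>2 x - \<omega> x"
  by (cases x) (simp_all add: center_def unital_functionalD[OF assms(1)] unital_functionalD[OF assms(2)])

lemma letter_decompose: "letter x = letter (center \<omega> x) + \<omega> x *\<^sub>C 1"
  by (simp add: letter_center)

text \<open>Here \<open>\<omega>\<close> is any function on letters. It becomes the centring pair
  when vanishing is deduced from c-freeness, and the pair \<open>\<chi>\<close> of values in the
  converse.\<close>

lemma functional_word_prod_Cons: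
  assumes "unital_functional \<phi>"
  shows "\<phi> (word_prod (x # xs)) =
    \<phi> (word_prod (center \<omega> x # xs)) + \<omega> x * \<phi> (word_prod xs)"
  unfolding word_prod_simps letter_decompose[of x \<omega>]
  by (simp add: distrib_right mult_scaleC_left unital_functionalD[OF assms])

lemma functional_word_prod_snoc:
  assumes "unital_functional \<phi>"
  shows "\<phi> (word_prod (xs @ [x])) =
    \<phi> (word_prod (xs @ [center \<omega> x])) + \<omega> x * \<phi> (word_prod xs)"
  unfolding word_prod_simps letter_decompose[of x \<omega>]
  by (simp add: distrib_left mult_scaleC_right unital_functionalD[OF assms])


section \<open>Vanishing on kernels and c-freeness\<close>

text \<open>Admitting the empty word costs nothing, since its product formula reads \<phi>(1) = 1;
  inductions on words can then start there.\<close>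

lemma is_cfree_product_iff:
  "is_cfree_product \<phi>\<^sub>1 \<omega>\<^sub>1 \<omega>\<^sub>2 \<phi>\<^sub>2 \<phi> \<longleftrightarrow> unital_functional \<phi> \<and>
     (\<forall>xs. alternating xs \<longrightarrow> (\<forall>x\<in>set xs. case_sum \<omega>\<^sub>1 \<omega>\<^sub>2 x = 0) \<longrightarrow>
        \<phi> (word_prod xs) = prod_list (map (case_sum \<phi>\<^sub>1 \<phi>\<^sub>2) xs))" (is "?L \<longleftrightarrow> ?R")
proof -
  have prod: "(\<Prod>k<length xs. f (xs ! k)) = prod_list (map f xs)" for f :: "_ \<Rightarrow> complex" and xs
    by (simp add: prod.list_conv_set_nth atLeast0LessThan)
  have "?L \<longleftrightarrow> unital_functional \<phi> \<and>
     (\<forall>xs. xs \<noteq> [] \<and> alternating xs \<longrightarrow> (\<forall>x\<in>set xs. case_sum \<omega>\<^sub>1 \<omega>\<^sub>2 x = 0) \<longrightarrow>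
        \<phi> (word_prod xs) = prod_list (map (case_sum \<phi>\<^sub>1 \<phi>\<^sub>2) xs))"
    unfolding is_cfree_product_def prod
    by (simp add: map_index_in_I_star_iff[symmetric] all_set_conv_all_nth) blast
  also have "\<dots> \<longleftrightarrow> ?R"
  proof (intro conj_cong refl iff_allI)
    fix xs assume "unital_functional \<phi>"
    then show "(xs \<noteq> [] \<and> alternating xs \<longrightarrow> (\<forall>x\<in>set xs. case_sum \<omega>\<^sub>1 \<omega>\<^sub>2 x = 0) \<longrightarrow>
        \<phi> (word_prod xs) = prod_list (map (case_sum \<phi>\<^sub>1 \<phi>\<^sub>2) xs)) \<longleftrightarrow>
      (alternating xs \<longrightarrow> (\<forall>x\<in>set xs. case_sum \<omega>\<^sub>1 \<omega>\<^sub>2 x = 0) \<longrightarrow>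
        \<phi> (word_prod xs) = prod_list (map (case_sum \<phi>\<^sub>1 \<phi>\<^sub>2) xs))"
      by (cases "xs = []") (simp_all add: unital_functionalD)
  qed
  finally show ?thesis .
qed

text \<open>Both neighbours of an interior letter carry the other of the two indices, so it lies
  above both or below both.\<close>

lemma
  assumes "alternating xs" "0 < k" "Suc k < length xs"
  shows Peak_alternating_iff: "k \<in> Peak (map index xs) \<longleftrightarrow> index (xs ! k) = 2"
    and Bot_alternating_iff: "k \<in> Bot (map index xs) \<longleftrightarrow> index (xs ! k) = 1"
proof -
  have "index (xs ! (k - 1)) \<noteq> index (xs ! k)" "index (xs ! k) \<noteq> index (xs ! Suc k)"
    using alternating_nth[OF assms(1), of "k - 1"] alternating_nth[OF assms(1), of k] assms(2,3)
    by simp_all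
  then show "k \<in> Peak (map index xs) \<longleftrightarrow> index (xs ! k) = 2"
    "k \<in> Bot (map index xs) \<longleftrightarrow> index (xs ! k) = 1"
    unfolding Peak_def Bot_def
    using assms index_range[of "xs ! (k - 1)"] index_range[of "xs ! k"] index_range[of "xs ! Suc k"]
    by auto
qed

text \<open>Peaks have index 2 and meet \<open>\<psi>\<^sub>2\<close>, bottoms have index 1 and meet
  \<open>\<theta>\<^sub>1\<close>; this produces the mixed pair. The last letter of a longer word is
  neither, so it is unconstrained, whence \<open>butlast\<close>.\<close>

lemma vanishes_on_kernels_iff:
  "vanishes_on_kernels (word_functional \<chi> (case_sum \<psi>\<^sub>1 \<psi>\<^sub>2) (case_sum \<theta>\<^sub>1 \<theta>\<^sub>2)) \<phi> \<longleftrightarrow>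
     (\<forall>x xs. alternating (x # xs) \<longrightarrow> \<chi> x = 0 \<longrightarrow>
        (\<forall>y\<in>set (butlast xs). case_sum \<theta>\<^sub>1 \<psi>\<^sub>2 y = 0) \<longrightarrow> \<phi> (word_prod (x # xs)) = 0)"
proof -
  have *: "(\<forall>k<length (x # xs). word_functional \<chi> (case_sum \<psi>\<^sub>1 \<psi>\<^sub>2) (case_sum \<theta>\<^sub>1 \<theta>\<^sub>2)
        (map index (x # xs)) k ((x # xs) ! k) = 0) \<longleftrightarrow>
      \<chi> x = 0 \<and> (\<forall>y\<in>set (butlast xs). case_sum \<theta>\<^sub>1 \<psi>\<^sub>2 y = 0)"
    if alt: "alternating (x # xs)" for x xs
  proof -
    let ?is = "map index (x # xs)"
    \<comment> \<open>Position \<open>k\<close> of the tail is position \<open>k + 1\<close> of the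
      word. It is interior unless it ends the word, where the functional is 0.\<close>
    have wf: "word_functional \<chi> (case_sum \<psi>\<^sub>1 \<psi>\<^sub>2) (case_sum \<theta>\<^sub>1 \<theta>\<^sub>2) ?is (Suc k) ((x # xs) ! Suc k) =
        (if k < length xs - 1 then case_sum \<theta>\<^sub>1 \<psi>\<^sub>2 (xs ! k) else 0)" if "k < length xs" for k
    proof (cases "Suc k < length xs")
      case True
      then have "Suc k \<in> Peak ?is \<longleftrightarrow> index (xs ! k) = 2" "Suc k \<in> Bot ?is \<longleftrightarrow> index (xs ! k) = 1"
        using Peak_alternating_iff[OF alt, of "Suc k"] Bot_alternating_iff[OF alt, of "Suc k"] by simp_all
      then show ?thesis
        using True by (cases "xs ! k") (simp_all add: word_functional_def less_diff_conv)
    next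
      case False
      then show ?thesis
        using that by (auto simp: word_functional_def Peak_def Bot_def)
    qed
    have "(\<forall>k<length (x # xs). word_functional \<chi> (case_sum \<psi>\<^sub>1 \<psi>\<^sub>2) (case_sum \<theta>\<^sub>1 \<theta>\<^sub>2)
        ?is k ((x # xs) ! k) = 0) \<longleftrightarrow>
      \<chi> x = 0 \<and> (\<forall>k<length xs. (if k < length xs - 1 then case_sum \<theta>\<^sub>1 \<psi>\<^sub>2 (xs ! k) else 0) = 0)"
      unfolding length_Cons All_less_Suc2 using wf by (simp add: word_functional_def)
    also have "\<dots> \<longleftrightarrow> \<chi> x = 0 \<and> (\<forall>y\<in>set (butlast xs). case_sum \<theta>\<^sub>1 \<psi>\<^sub>2 y = 0)"
      by (auto simp: all_set_conv_all_nth nth_butlast)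
    finally show ?thesis .
  qed
  show ?thesis
    unfolding vanishes_on_kernels_def
    apply (intro iffI allI ballI impI)
    subgoal for x xs
      using map_index_in_I_star_iff[of "x # xs"] *[of x xs] by blast
    subgoal for _ xs
      by (cases xs) (use map_index_in_I_star_iff[of xs] * in \<open>blast+\<close>)
    done
qed

context
  fixes \<chi>\<^sub>1 \<omega>\<^sub>1 :: "'a::complex_algebra_1 \<Rightarrow> complex" and \<chi>\<^sub>2 \<omega>\<^sub>2 :: "'b::complex_algebra_1 \<Rightarrow> complex"
  assumes unital: "unital_functional \<chi>\<^sub>1" "unital_functional \<omega>\<^sub>1"
    "unital_functional \<chi>\<^sub>2" "unital_functional \<omega>\<^sub>2"
begin

text \<open>The pair \<open>\<omega>\<close> decides which letters are centred, the pair
  \<open>\<chi>\<close> gives the factors of the product formula.\<close>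

private abbreviation (input) "\<chi> \<equiv> case_sum \<chi>\<^sub>1 \<chi>\<^sub>2"
private abbreviation (input) "\<omega> \<equiv> case_sum \<omega>\<^sub>1 \<omega>\<^sub>2"

lemmas \<chi>_center = functional_center[OF unital(1,3)]
lemmas \<omega>_center = functional_center[OF unital(2,4)]

text \<open>Each end letter is a centred letter plus a scalar, and deleting an end letter keeps a
  word alternating. The two contributions \<chi>(x) - \<omega>(x) and \<omega>(x) add up to the
  factor \<chi>(x). The last letter is treated first, then the first one.\<close>

lemma cfree_word_interior:
  assumes cfree: "is_cfree_product \<chi>\<^sub>1 \<omega>\<^sub>1 \<omega>\<^sub>2 \<chi>\<^sub>2 \<phi>"
    and alt: "alternating (x # xs)" and interior: "\<forall>y\<in>set (butlast xs). \<omega> y = 0"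
  shows "\<phi> (word_prod (x # xs)) = prod_list (map \<chi> (x # xs))"
proof -
  have \<phi>: "unital_functional \<phi>"
    using cfree by (simp add: is_cfree_product_iff)
  have centered: "\<phi> (word_prod ys) = prod_list (map \<chi> ys)"
    if "alternating ys" "\<forall>y\<in>set ys. \<omega> y = 0" for ys
    using cfree that by (simp add: is_cfree_product_iff)
  have last: "\<phi> (word_prod ys) = prod_list (map \<chi> ys)"
    if alt: "alternating ys" and *: "\<forall>y\<in>set (butlast ys). \<omega> y = 0" for ys
  proof (cases ys rule: rev_cases)
    case Nil
    then show ?thesis by (simp add: unital_functionalD[OF \<phi>])
  next
    case (snoc zs z)
    have "alternating (zs @ [center \<omega> z])"
      using alt alternating_cong[of "zs @ [center \<omega> z]" ys] snoc by simp
    then have "\<phi> (word_prod (zs @ [center \<omega> z])) = prod_list (map \<chi> (zs @ [center \<omega> z]))"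
      using * snoc by (intro centered) (auto simp: \<omega>_center)
    moreover have "\<phi> (word_prod zs) = prod_list (map \<chi> zs)"
      using alt * snoc by (intro centered) (auto simp: successively_append_iff)
    ultimately show ?thesis
      unfolding snoc functional_word_prod_snoc[OF \<phi>, of zs z \<omega>]
      by (simp add: \<chi>_center algebra_simps)
  qed
  have "alternating (center \<omega> x # xs)"
    using alt alternating_cong[of "center \<omega> x # xs" "x # xs"] by simp
  then have "\<phi> (word_prod (center \<omega> x # xs)) = prod_list (map \<chi> (center \<omega> x # xs))"
    using interior by (intro last) (auto simp: \<omega>_center)
  moreover have "\<phi> (word_prod xs) = prod_list (map \<chi> xs)"
    using alt interior by (intro last) (auto simp: successively_Cons)
  ultimately show ?thesis
    unfolding functional_word_prod_Cons[OF \<phi>, of x xs \<omega>]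
    by (simp add: \<chi>_center algebra_simps)
qed

text \<open>From left to right, the product contains the factor \<chi>(x) = 0 of the first letter.
  Conversely, the first letter is shifted by \<chi>(x), not \<omega>(x): the shifted word is killed,
  and the scalar part leaves \<chi>(x) times a shorter word.\<close>

lemma is_cfree_product_iff_vanishes:
  "is_cfree_product \<chi>\<^sub>1 \<omega>\<^sub>1 \<omega>\<^sub>2 \<chi>\<^sub>2 \<phi> \<longleftrightarrow>
     unital_functional \<phi> \<and> vanishes_on_kernels (word_functional \<chi> (case_sum \<psi>\<^sub>1 \<omega>\<^sub>2) (case_sum \<omega>\<^sub>1 \<theta>\<^sub>2)) \<phi>"
  (is "?L \<longleftrightarrow> ?R")
proof
  assume ?L
  then show ?R
    using cfree_word_interior[OF \<open>?L\<close>]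
    by (auto simp: vanishes_on_kernels_iff is_cfree_product_iff simp del: word_prod_simps)
next
  assume R: ?R
  then have \<phi>: "unital_functional \<phi>" by simp
  have "\<phi> (word_prod xs) = prod_list (map \<chi> xs)"
    if "alternating xs" "\<forall>y\<in>set (butlast (tl xs)). \<omega> y = 0" for xs
    using that
  proof (induction xs)
    case Nil
    then show ?case by (simp add: unital_functionalD[OF \<phi>])
  next
    case (Cons x xs)
    have "alternating (center \<chi> x # xs)"
      using Cons alternating_cong[of "center \<chi> x # xs" "x # xs"] by simp
    then have "\<phi> (word_prod (center \<chi> x # xs)) = 0"
      using Cons R unfolding vanishes_on_kernels_iff
      by (simp add: \<chi>_center del: word_prod_simps)
    moreover have "\<phi> (word_prod xs) = prod_list (map \<chi> xs)"
    proof (rule Cons.IH)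
      show "alternating xs"
        using Cons.prems(1) by (auto simp: successively_Cons)
      show "\<forall>y\<in>set (butlast (tl xs)). \<omega> y = 0"
        using Cons.prems(2) by (metis butlast_tl list.sel(3) list.set_sel(2) tl_Nil)
    qed
    ultimately show ?case
      unfolding functional_word_prod_Cons[OF \<phi>, of x xs \<chi>] by simp
  qed
  moreover have "\<forall>y\<in>set (butlast (tl xs)). \<omega> y = 0" if "\<forall>y\<in>set xs. \<omega> y = 0" for xs
    using that by (metis in_set_butlastD list.set_sel(2) tl_Nil)
  ultimately show ?L
    using \<phi> by (simp add: is_cfree_product_iff)
qed

section \<open>Uniqueness\<close>

definition centered_span :: "('a, 'b) free_product set" where
  "centered_span = complex_algebra.span (word_prod ` {xs. alternating xs \<and> (\<forall>x\<in>set xs. \<omega> x = 0)})"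

lemma word_in_centered_span:
  "alternating xs \<Longrightarrow> (\<forall>x\<in>set xs. \<omega> x = 0) \<Longrightarrow> word_prod xs \<in> centered_span"
  by (auto simp: centered_span_def intro!: complex_algebra.span_base)

lemma centered_span_intros:
  "x \<in> centered_span \<Longrightarrow> y \<in> centered_span \<Longrightarrow> x + y \<in> centered_span"
  "x \<in> centered_span \<Longrightarrow> c *\<^sub>C x \<in> centered_span"
  unfolding centered_span_def
  by (rule complex_algebra.span_add complex_algebra.span_scale; assumption)+

text \<open>If \<open>x\<close> has another index than the first letter, centring \<open>x\<close>
  gives two centred words. Otherwise \<open>x\<close> is merged with the first letter; the result
  need not be centred, but it precedes a word of the other index, which is the previous
  case.\<close>

lemma letter_mult_word_in_centered_span:
  assumes alt: "alternating xs" and xs: "\<forall>y\<in>set xs. \<omega> y = 0"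
  shows "letter x * word_prod xs \<in> centered_span"
proof -
  have opposite: "letter x * word_prod ys \<in> centered_span"
    if "alternating (x # ys)" "\<forall>y\<in>set ys. \<omega> y = 0" for x ys
  proof -
    have "alternating (center \<omega> x # ys)"
      using that alternating_cong[of "center \<omega> x # ys" "x # ys"] by simp
    then have "word_prod (center \<omega> x # ys) \<in> centered_span"
      using that by (intro word_in_centered_span) (auto simp: \<omega>_center)
    moreover have "word_prod ys \<in> centered_span"
      using that by (intro word_in_centered_span) (auto simp: successively_Cons)
    ultimately show ?thesis
      unfolding letter_decompose[of x \<omega>] distrib_right mult_scaleC_left mult_1_left
      by (intro centered_span_intros) simp_all
  qed
  show ?thesis
  proof (cases "alternating (x # xs)")
    case True
    then show ?thesis using opposite xs by simp
  next
    case False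
    then obtain y ys where ys: "xs = y # ys" and same: "index x = index y"
      using alt by (cases xs) auto
    \<comment> \<open>The product of both letters in their common algebra; the default
      \<open>x\<close> is reached only when the indices differ.\<close>
    define z where "z = (case (x, y) of (Inl a, Inl b) \<Rightarrow> Inl (a * b) | (Inr a, Inr b) \<Rightarrow> Inr (a * b) | _ \<Rightarrow> x)"
    have z: "index z = index y" "letter x * letter y = letter z"
      using same by (cases x; cases y; simp add: z_def unital_homD unital_hom_fp_inl unital_hom_fp_inr)+
    have "alternating (z # ys)"
      using alt alternating_cong[of "z # ys" "y # ys"] z ys by simp
    then have "letter z * word_prod ys \<in> centered_span"
      using xs ys by (intro opposite) auto
    then show ?thesis
      by (simp add: ys z(2) flip: mult.assoc)
  qed
qed

lemma letter_mult_in_centered_span: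
  assumes "s \<in> centered_span"
  shows "letter x * s \<in> centered_span"
  using assms[unfolded centered_span_def]
proof (induction rule: complex_algebra.span_induct_alt)
  case base
  then show ?case by (simp add: centered_span_def complex_algebra.span_zero)
next
  case (step c w s)
  then show ?case
    unfolding distrib_left mult_scaleC_right
    by (auto intro!: centered_span_intros letter_mult_word_in_centered_span)
qed

text \<open>The span is stable under left multiplication by every term and contains 1, the empty
  word. The element \<open>s\<close> varies because a product of terms acts in two stages.\<close>

lemma centered_span_eq_UNIV: "x \<in> centered_span"
proof -
  have "abs_free_product t * s \<in> centered_span" if "s \<in> centered_span" for t s
    using that
  proof (induction t arbitrary: s)
    case (Left a)
    then show ?case
      using letter_mult_in_centered_span[of s "Inl a"] by (simp add: fp_inl.abs_eq)
  next
    case (Right b)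
    then show ?case
      using letter_mult_in_centered_span[of s "Inr b"] by (simp add: fp_inr.abs_eq)
  qed (auto simp: distrib_right mult_scaleC_left mult.assoc intro!: centered_span_intros
      simp flip: plus_free_product.abs_eq times_free_product.abs_eq scaleC_free_product.abs_eq)
  moreover have "1 \<in> centered_span"
    using word_in_centered_span[of "[]"] by simp
  ultimately have "abs_free_product t \<in> centered_span" for t
    by (metis mult_1_right)
  then show ?thesis
    by (metis Quotient3_abs_rep[OF Quotient3_free_product])
qed

lemma is_cfree_product_unique:
  assumes \<phi>: "is_cfree_product \<chi>\<^sub>1 \<omega>\<^sub>1 \<omega>\<^sub>2 \<chi>\<^sub>2 \<phi>" and \<phi>': "is_cfree_product \<chi>\<^sub>1 \<omega>\<^sub>1 \<omega>\<^sub>2 \<chi>\<^sub>2 \<phi>'"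
  shows "\<phi> = \<phi>'"
proof
  fix x
  show "\<phi> x = \<phi>' x"
    using centered_span_eq_UNIV[of x, unfolded centered_span_def]
  proof (induction rule: complex_algebra.span_induct_alt)
    case base
    then show ?case using \<phi> \<phi>' by (simp add: is_cfree_product_iff unital_functionalD)
  next
    case (step c w s)
    then show ?case using \<phi> \<phi>' by (auto simp: is_cfree_product_iff unital_functionalD)
  qed
qed

section \<open>Existence\<close>

text \<open>The functionals on \<open>\<complex>\<close> plus the alternating tensor products of the quotients
  \<open>\<A>\<^sub>i / \<complex>1\<close>, where the letter \<open>x\<close> of a word stands for \<open>x - \<omega>(x)1\<close>.\<close>

definition word_functionals :: "(('a + 'b) list \<Rightarrow> complex) set" where
  "word_functionals = {f. (\<forall>w. \<not> alternating w \<longrightarrow> f w = 0) \<and>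
     (\<forall>u v.
       (\<forall>a a'. f (u @ Inl (a + a') # v) = f (u @ Inl a # v) + f (u @ Inl a' # v)) \<and>
       (\<forall>c a. f (u @ Inl (c *\<^sub>C a) # v) = c * f (u @ Inl a # v)) \<and>
       f (u @ Inl 1 # v) = 0 \<and>
       (\<forall>b b'. f (u @ Inr (b + b') # v) = f (u @ Inr b # v) + f (u @ Inr b' # v)) \<and>
       (\<forall>c b. f (u @ Inr (c *\<^sub>C b) # v) = c * f (u @ Inr b # v)) \<and>
       f (u @ Inr 1 # v) = 0)}"

text \<open>The transpose of left multiplication by a letter, from
  \<open>a (b - \<omega>(b)1) = (ab - \<omega>(ab)1) - \<omega>(b) (a - \<omega>(a)1) + (\<omega>(ab) - \<omega>(b) \<omega>(a)) 1\<close>.\<close>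

fun mult_letter :: "'a + 'b \<Rightarrow> (('a + 'b) list \<Rightarrow> complex) \<Rightarrow> ('a + 'b) list \<Rightarrow> complex" where
  "mult_letter (Inl a) f (Inl b # w) =
     f (Inl (a * b) # w) - \<omega>\<^sub>1 b * f (Inl a # w) + (\<omega>\<^sub>1 (a * b) - \<omega>\<^sub>1 b * \<omega>\<^sub>1 a) * f w"
| "mult_letter (Inr a) f (Inr b # w) =
     f (Inr (a * b) # w) - \<omega>\<^sub>2 b * f (Inr a # w) + (\<omega>\<^sub>2 (a * b) - \<omega>\<^sub>2 b * \<omega>\<^sub>2 a) * f w"
| "mult_letter x f w = f (x # w) + \<omega> x * f w"

text \<open>The cut-off matters: on a word starting with two letters of equal index, the merging
  rule leaves a multiple of \<open>f w\<close> with a possibly alternating tail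
  \<open>w\<close>.\<close>

definition letter_action :: "'a + 'b \<Rightarrow> (('a + 'b) list \<Rightarrow> complex) \<Rightarrow> ('a + 'b) list \<Rightarrow> complex" where
  "letter_action x f w = (if alternating w then mult_letter x f w else 0)"

text \<open>In a product the left factor acts first, because transposes of left multiplications
  compose in reverse order.\<close>

primrec term_action :: "('a, 'b) fp_term \<Rightarrow> (('a + 'b) list \<Rightarrow> complex) \<Rightarrow> ('a + 'b) list \<Rightarrow> complex" where
  "term_action (Left a) f = letter_action (Inl a) f"
| "term_action (Right b) f = letter_action (Inr b) f"
| "term_action (Add s t) f = (\<lambda>w. term_action s f w + term_action t f w)"
| "term_action (Mul s t) f = term_action t (term_action s f)"
| "term_action (Scale c s) f = (\<lambda>w. c * term_action s f w)"

lemma word_functionalsD: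
  assumes "f \<in> word_functionals"
  shows "\<not> alternating w \<Longrightarrow> f w = 0"
    "f (u @ Inl (a + a') # v) = f (u @ Inl a # v) + f (u @ Inl a' # v)"
    "f (u @ Inl (c *\<^sub>C a) # v) = c * f (u @ Inl a # v)"
    "f (u @ Inl 1 # v) = 0"
    "f (u @ Inr (b + b') # v) = f (u @ Inr b # v) + f (u @ Inr b' # v)"
    "f (u @ Inr (c *\<^sub>C b) # v) = c * f (u @ Inr b # v)"
    "f (u @ Inr 1 # v) = 0"
  using assms by (auto simp: word_functionals_def)

text \<open>Changing a letter within its algebra keeps the index pattern, so on non-alternating
  words all conditions read 0 = 0.\<close>

lemma word_functionalsI:
  assumes zero: "\<And>w. \<not> alternating w \<Longrightarrow> f w = 0"
    and Inl: "\<And>u v a a'. (\<And>x. alternating (u @ Inl x # v)) \<Longrightarrow>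
        f (u @ Inl (a + a') # v) = f (u @ Inl a # v) + f (u @ Inl a' # v)"
      "\<And>u v c a. (\<And>x. alternating (u @ Inl x # v)) \<Longrightarrow> f (u @ Inl (c *\<^sub>C a) # v) = c * f (u @ Inl a # v)"
      "\<And>u v. (\<And>x. alternating (u @ Inl x # v)) \<Longrightarrow> f (u @ Inl 1 # v) = 0"
    and Inr: "\<And>u v b b'. (\<And>x. alternating (u @ Inr x # v)) \<Longrightarrow>
        f (u @ Inr (b + b') # v) = f (u @ Inr b # v) + f (u @ Inr b' # v)"
      "\<And>u v c b. (\<And>x. alternating (u @ Inr x # v)) \<Longrightarrow> f (u @ Inr (c *\<^sub>C b) # v) = c * f (u @ Inr b # v)"
      "\<And>u v. (\<And>x. alternating (u @ Inr x # v)) \<Longrightarrow> f (u @ Inr 1 # v) = 0"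
  shows "f \<in> word_functionals"
proof -
  have "alternating (u @ Inl x # v) \<longleftrightarrow> alternating (u @ Inl 1 # v)"
    "alternating (u @ Inr y # v) \<longleftrightarrow> alternating (u @ Inr 1 # v)" for u v and x :: 'a and y :: 'b
    by (simp_all add: alternating_replace)
  then have alt: "(\<forall>x. alternating (u @ Inl x # v)) \<or> (\<forall>x. \<not> alternating (u @ Inl x # v))"
    "(\<forall>y. alternating (u @ Inr y # v)) \<or> (\<forall>y. \<not> alternating (u @ Inr y # v))"
    for u v :: "('a + 'b) list"
    by blast+
  show ?thesis
    unfolding word_functionals_def mem_Collect_eq
  proof (intro conjI allI impI)
    fix u v a a' c b b'
    show "f (u @ Inl (a + a') # v) = f (u @ Inl a # v) + f (u @ Inl a' # v)"
      "f (u @ Inl (c *\<^sub>C a) # v) = c * f (u @ Inl a # v)"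
      "f (u @ Inl 1 # v) = 0"
      using alt(1)[of u v] Inl zero by auto
    show "f (u @ Inr (b + b') # v) = f (u @ Inr b # v) + f (u @ Inr b' # v)"
      "f (u @ Inr (c *\<^sub>C b) # v) = c * f (u @ Inr b # v)"
      "f (u @ Inr 1 # v) = 0"
      using alt(2)[of u v] Inr zero by auto
  qed (fact zero)
qed

text \<open>The delicate case is a changed letter at the head that gets merged. If it is 1, then
  \<omega>(1) = 1 makes the merged terms cancel.\<close>

lemma letter_action_in_word_functionals:
  assumes f: "f \<in> word_functionals"
  shows "letter_action x f \<in> word_functionals"
proof -
  \<comment> \<open>The rules are restated for a changed letter in first, second or later position,
    as acting may put one more letter in front.\<close>
  note f0 = word_functionalsD(2-)[OF f]
  note f1 = f0[of "[]", unfolded append_Nil]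
  note f2 = f0[of "y # u" for y u, unfolded append_Cons]
  note f3 = f2[of _ "[]", unfolded append_Nil]
  note f4 = f2[of _ "z # u" for z u, unfolded append_Cons]
  note lin = unital_functionalD[OF unital(2)] unital_functionalD[OF unital(4)]
  have u: "u = [] \<or> (\<exists>d u'. u = Inl d # u') \<or> (\<exists>e u'. u = Inr e # u')" for u :: "('a + 'b) list"
    by (metis list.exhaust obj_sumE)
  have mult:
    "mult_letter x f (u @ Inl (a + a') # v) = mult_letter x f (u @ Inl a # v) + mult_letter x f (u @ Inl a' # v)"
    "mult_letter x f (u @ Inl (c *\<^sub>C a) # v) = c * mult_letter x f (u @ Inl a # v)"
    "mult_letter x f (u @ Inl 1 # v) = 0"
    "mult_letter x f (u @ Inr (b + b') # v) = mult_letter x f (u @ Inr b # v) + mult_letter x f (u @ Inr b' # v)"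
    "mult_letter x f (u @ Inr (c *\<^sub>C b) # v) = c * mult_letter x f (u @ Inr b # v)"
    "mult_letter x f (u @ Inr 1 # v) = 0" for u v a a' b b' c
    using u[of u]
    by (elim disjE exE; cases x; hypsubst; simp only: append_Nil append_Cons
        mult_letter.simps sum.case f0 f1 f2 f3 f4 distrib_left mult_scaleC_right mult_1_right
        lin; simp add: algebra_simps)+
  show ?thesis
    by (rule word_functionalsI) (simp_all add: letter_action_def mult)
qed

lemma term_action_in_word_functionals:
  "f \<in> word_functionals \<Longrightarrow> term_action t f \<in> word_functionals"
proof (induction t arbitrary: f)
  case (Add s t)
  then have "term_action s f \<in> word_functionals" "term_action t f \<in> word_functionals"
    by auto
  then show ?case
    by (simp add: word_functionals_def algebra_simps)
next
  case (Scale c s)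
  then have "term_action s f \<in> word_functionals"
    by auto
  then show ?case
    by (simp add: word_functionals_def algebra_simps)
qed (auto intro: letter_action_in_word_functionals)

lemma mult_letter_linear:
  "mult_letter x (\<lambda>w. f w + g w) w = mult_letter x f w + mult_letter x g w"
  "mult_letter x (\<lambda>w. c * f w) w = c * mult_letter x f w"
  by (cases "(x, f, w)" rule: mult_letter.cases; simp add: algebra_simps)+

lemma letter_action_linear_right:
  "letter_action x (\<lambda>w. f w + g w) = (\<lambda>w. letter_action x f w + letter_action x g w)"
  "letter_action x (\<lambda>w. c * f w) = (\<lambda>w. c * letter_action x f w)"
  by (auto simp: letter_action_def mult_letter_linear fun_eq_iff)

text \<open>Serves the relations (s + t)u = su + tu and (cs)t = c(st), where the right factor acts
  on a linear combination.\<close>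

lemma term_action_linear:
  "term_action t (\<lambda>w. f w + g w) = (\<lambda>w. term_action t f w + term_action t g w)"
  "term_action t (\<lambda>w. c * f w) = (\<lambda>w. c * term_action t f w)"
  by (induction t arbitrary: f g)
    (simp_all add: letter_action_linear_right algebra_simps)

text \<open>If the word starts in the same algebra, this is associativity there; otherwise the first
  action prepends a letter that the second merges. In both cases the extra scalar terms
  cancel.\<close>

lemma letter_action_mult:
  "letter_action (Inl (a * a')) f = letter_action (Inl a') (letter_action (Inl a) f)"
  "letter_action (Inr (b * b')) f = letter_action (Inr b') (letter_action (Inr b) f)"
proof -
  have "letter_action (Inl (a * a')) f w = letter_action (Inl a') (letter_action (Inl a) f) w" for w
  proof (cases w)
    case (Cons x v)
    show ?thesis
      unfolding Cons
      \<comment> \<open>The second letter matters because the scalar part of a merge evaluates the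
        inner action at the tail \<open>v\<close>.\<close>
      by (cases x; cases v; cases "hd v")
        (auto simp: letter_action_def algebra_simps successively_Cons)
  qed (simp add: letter_action_def algebra_simps)
  then show "letter_action (Inl (a * a')) f = letter_action (Inl a') (letter_action (Inl a) f)" ..
  have "letter_action (Inr (b * b')) f w = letter_action (Inr b') (letter_action (Inr b) f) w" for w
  proof (cases w)
    case (Cons x v)
    show ?thesis
      unfolding Cons
      by (cases x; cases v; cases "hd v")
        (auto simp: letter_action_def algebra_simps successively_Cons)
  qed (simp add: letter_action_def algebra_simps)
  then show "letter_action (Inr (b * b')) f = letter_action (Inr b') (letter_action (Inr b) f)" ..
qed

text \<open>Here multilinearity of \<open>f\<close> and its vanishing on letters 1 and off
  alternating words enter. The rule for \<open>Inl 0\<close> is included because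
  \<open>Left 0\<close> represents zero.\<close>

lemma letter_action_linear:
  assumes f: "f \<in> word_functionals"
  shows "letter_action (Inl (a + a')) f = (\<lambda>w. letter_action (Inl a) f w + letter_action (Inl a') f w)"
    "letter_action (Inl (c *\<^sub>C a)) f = (\<lambda>w. c * letter_action (Inl a) f w)"
    "letter_action (Inr (b + b')) f = (\<lambda>w. letter_action (Inr b) f w + letter_action (Inr b') f w)"
    "letter_action (Inr (c *\<^sub>C b)) f = (\<lambda>w. c * letter_action (Inr b) f w)"
    "letter_action (Inl 1) f = f"
    "letter_action (Inr 1) f = f"
    "letter_action (Inl 0) f = (\<lambda>w. 0)"
proof -
  note f0 = word_functionalsD(2-)[OF f, of "[]", unfolded append_Nil]
  note lin = unital_functionalD[OF unital(2)] unital_functionalD[OF unital(4)]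
  have f00: "f (Inl 0 # v) = 0" for v
    using f0(2)[of 0 0 v] by simp
  have mult: "mult_letter (Inl (a + a')) f w = mult_letter (Inl a) f w + mult_letter (Inl a') f w"
    "mult_letter (Inl (c *\<^sub>C a)) f w = c * mult_letter (Inl a) f w"
    "mult_letter (Inr (b + b')) f w = mult_letter (Inr b) f w + mult_letter (Inr b') f w"
    "mult_letter (Inr (c *\<^sub>C b)) f w = c * mult_letter (Inr b) f w"
    "mult_letter (Inl 1) f w = f w"
    "mult_letter (Inr 1) f w = f w"
    "mult_letter (Inl 0) f w = 0" for w
  proof -
    have w: "w = [] \<or> (\<exists>d v. w = Inl d # v) \<or> (\<exists>e v. w = Inr e # v)"
      by (metis list.exhaust obj_sumE)
    show "mult_letter (Inl (a + a')) f w = mult_letter (Inl a) f w + mult_letter (Inl a') f w"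
      "mult_letter (Inl (c *\<^sub>C a)) f w = c * mult_letter (Inl a) f w"
      "mult_letter (Inr (b + b')) f w = mult_letter (Inr b) f w + mult_letter (Inr b') f w"
      "mult_letter (Inr (c *\<^sub>C b)) f w = c * mult_letter (Inr b) f w"
      "mult_letter (Inl 1) f w = f w"
      "mult_letter (Inr 1) f w = f w"
      "mult_letter (Inl 0) f w = 0"
      using w
      by (elim disjE exE; hypsubst; simp only: mult_letter.simps sum.case f0 f00 lin
          distrib_right mult_scaleC_left mult_1_left mult_zero_left; simp add: algebra_simps)+
  qed
  show "letter_action (Inl (a + a')) f = (\<lambda>w. letter_action (Inl a) f w + letter_action (Inl a') f w)"
    "letter_action (Inl (c *\<^sub>C a)) f = (\<lambda>w. c * letter_action (Inl a) f w)"
    "letter_action (Inr (b + b')) f = (\<lambda>w. letter_action (Inr b) f w + letter_action (Inr b') f w)"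
    "letter_action (Inr (c *\<^sub>C b)) f = (\<lambda>w. c * letter_action (Inr b) f w)"
    "letter_action (Inl 1) f = f"
    "letter_action (Inr 1) f = f"
    "letter_action (Inl 0) f = (\<lambda>w. 0)"
    using word_functionalsD(1)[OF f]
    by (auto simp: letter_action_def mult fun_eq_iff)
qed

text \<open>The action descends to the free product: every defining relation holds on the invariant
  space \<open>word_functionals\<close>. The functional varies since a right factor acts on the
  image under the left one.\<close>

lemma term_action_cong:
  assumes "fp_rel s t" "f \<in> word_functionals"
  shows "term_action s f = term_action t f"
  using assms
  by (induction arbitrary: f)
    (simp_all add: algebra_simps term_action_linear letter_action_mult letter_action_linear
      term_action_in_word_functionals)

text \<open>A letter \<open>x\<close> stands for x - \<omega>(x)1, on which \<chi> takes the value
  \<chi>(x) - \<omega>(x).\<close>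

definition product_functional :: "('a + 'b) list \<Rightarrow> complex" where
  "product_functional w = (if alternating w then \<Prod>x\<leftarrow>w. \<chi> x - \<omega> x else 0)"

lemma product_functional_in_word_functionals: "product_functional \<in> word_functionals"
proof -
  note lin = unital_functionalD[OF unital(1)] unital_functionalD[OF unital(2)]
    unital_functionalD[OF unital(3)] unital_functionalD[OF unital(4)]
  show ?thesis
    by (rule word_functionalsI) (simp_all add: product_functional_def lin algebra_simps)
qed

text \<open>Dually, an element of the free product is applied to the empty word, which represents 1,
  and \<open>product_functional\<close> is evaluated on the result.\<close>

lift_definition cfree_functional :: "('a, 'b) free_product \<Rightarrow> complex"
  is "\<lambda>t. term_action t product_functional []"
  by (simp add: term_action_cong product_functional_in_word_functionals)

lemma unital_cfree_functional: "unital_functional cfree_functional"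
  by (rule unital_functionalI; transfer)
    (simp_all add: letter_action_linear product_functional_in_word_functionals product_functional_def)

definition word_term :: "('a + 'b) list \<Rightarrow> ('a, 'b) fp_term" where
  "word_term xs = foldr (\<lambda>x. Mul (case_sum Left Right x)) xs (Left 1)"

lemma abs_word_term: "abs_free_product (word_term xs) = word_prod xs"
proof (induction xs)
  case Nil
  then show ?case by (simp add: word_term_def one_free_product.abs_eq)
next
  case (Cons x xs)
  then show ?case
    by (cases x) (simp_all add: word_term_def fp_inl.abs_eq fp_inr.abs_eq flip: times_free_product.abs_eq)
qed

text \<open>A centred letter in front of a word of the other index is simply prepended, as its
  scalar term \<omega>(x) vanishes. The first letter acts first, so \<open>f\<close> varies in the
  induction.\<close>

lemma term_action_word_term:
  assumes "f \<in> word_functionals" "alternating xs" "\<forall>x\<in>set xs. \<omega> x = 0"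
  shows "term_action (word_term xs) f [] = f xs"
  using assms
proof (induction xs arbitrary: f)
  case Nil
  then show ?case by (simp add: word_term_def letter_action_linear)
next
  case (Cons x xs)
  have alt: "alternating xs" "xs = [] \<or> index x \<noteq> index (hd xs)"
    using Cons.prems(2) by (auto simp: successively_Cons)
  have "term_action (word_term (x # xs)) f [] = term_action (word_term xs) (letter_action x f) []"
    by (cases x) (simp_all add: word_term_def)
  also have "\<dots> = letter_action x f xs"
    using Cons alt by (intro Cons.IH) (auto intro: letter_action_in_word_functionals)
  also have "\<dots> = f (x # xs)"
    using Cons.prems(3) alt
    by (cases x; cases xs; cases "hd xs") (simp_all add: letter_action_def)
  finally show ?case .
qed

lemma is_cfree_product_cfree_functional: "is_cfree_product \<chi>\<^sub>1 \<omega>\<^sub>1 \<omega>\<^sub>2 \<chi>\<^sub>2 cfree_functional"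
  unfolding is_cfree_product_iff
proof (intro conjI allI impI unital_cfree_functional)
  fix xs
  assume alt: "alternating xs" and centered: "\<forall>x\<in>set xs. \<omega> x = 0"
  have "cfree_functional (word_prod xs) = product_functional xs"
    using term_action_word_term[OF product_functional_in_word_functionals alt centered]
    by (simp add: cfree_functional.abs_eq flip: abs_word_term)
  also have "\<dots> = prod_list (map \<chi> xs)"
    using alt centered by (simp add: product_functional_def cong: map_cong)
  finally show "cfree_functional (word_prod xs) = prod_list (map \<chi> xs)" .
qed

lemma is_cfree_product_iff_eq:
  "is_cfree_product \<chi>\<^sub>1 \<omega>\<^sub>1 \<omega>\<^sub>2 \<chi>\<^sub>2 \<phi> \<longleftrightarrow> \<phi> = cfree_product \<chi>\<^sub>1 \<omega>\<^sub>1 \<omega>\<^sub>2 \<chi>\<^sub>2"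
  unfolding cfree_product_def
  by (metis is_cfree_product_cfree_functional is_cfree_product_unique the_equality)

end

theorem proposition2p10:
  fixes \<phi>\<^sub>1 \<psi>\<^sub>1 \<theta>\<^sub>1 :: "'a::complex_algebra_1 \<Rightarrow> complex"
    and \<phi>\<^sub>2 \<psi>\<^sub>2 \<theta>\<^sub>2 :: "'b::complex_algebra_1 \<Rightarrow> complex"
  assumes "unital_functional \<phi>\<^sub>1" "unital_functional \<psi>\<^sub>1" "unital_functional \<theta>\<^sub>1"
    and "unital_functional \<phi>\<^sub>2" "unital_functional \<psi>\<^sub>2" "unital_functional \<theta>\<^sub>2"
  shows "alpha_free_product (\<phi>\<^sub>1, \<psi>\<^sub>1, \<theta>\<^sub>1) (\<phi>\<^sub>2, \<psi>\<^sub>2, \<theta>\<^sub>2) =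
    (cfree_product \<phi>\<^sub>1 \<theta>\<^sub>1 \<psi>\<^sub>2 \<phi>\<^sub>2,
     cfree_product \<psi>\<^sub>1 \<theta>\<^sub>1 \<psi>\<^sub>2 \<psi>\<^sub>2,
     cfree_product \<theta>\<^sub>1 \<theta>\<^sub>1 \<psi>\<^sub>2 \<theta>\<^sub>2)"
proof -
  \<comment> \<open>The centring pair is fixed as \<open>(\<theta>\<^sub>1, \<psi>\<^sub>2)\<close>,
    while \<chi> runs through the three families.\<close>
  have char: "unital_functional \<phi> \<and>
      vanishes_on_kernels (word_functional (case_sum \<chi>\<^sub>1 \<chi>\<^sub>2) (case_sum \<psi>\<^sub>1 \<psi>\<^sub>2) (case_sum \<theta>\<^sub>1 \<theta>\<^sub>2)) \<phi> \<longleftrightarrow>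
      \<phi> = cfree_product \<chi>\<^sub>1 \<theta>\<^sub>1 \<psi>\<^sub>2 \<chi>\<^sub>2"
    if "unital_functional \<chi>\<^sub>1" "unital_functional \<chi>\<^sub>2" for \<chi>\<^sub>1 \<chi>\<^sub>2 \<phi>
    using is_cfree_product_iff_vanishes[OF that(1) assms(3) that(2) assms(5)]
      is_cfree_product_iff_eq[OF that(1) assms(3) that(2) assms(5)]
    by metis
  have "is_alpha_free_product (\<phi>\<^sub>1, \<psi>\<^sub>1, \<theta>\<^sub>1) (\<phi>\<^sub>2, \<psi>\<^sub>2, \<theta>\<^sub>2) S \<longleftrightarrow>
      S = (cfree_product \<phi>\<^sub>1 \<theta>\<^sub>1 \<psi>\<^sub>2 \<phi>\<^sub>2, cfree_product \<psi>\<^sub>1 \<theta>\<^sub>1 \<psi>\<^sub>2 \<psi>\<^sub>2, cfree_product \<theta>\<^sub>1 \<theta>\<^sub>1 \<psi>\<^sub>2 \<theta>\<^sub>2)"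
    for S
  proof (cases S)
    case (fields \<phi> \<psi> \<theta>)
    show ?thesis
      unfolding fields is_alpha_free_product.simps prod.inject
      using char[OF assms(1,4), of \<phi>] char[OF assms(2,5), of \<psi>] char[OF assms(3,6), of \<theta>]
      by blast
  qed
  then show ?thesis
    by (simp add: alpha_free_product_def)
qed

end
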